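(* For all $m\in\mathbb{N}\setminus\{0,1\}$, $\mathscr{R}_{m}=\mathscr{C}(m,A)$, where $A=\{1,\ldots,m-1\}^2\setminus\{(1,1),(2,2),\ldots,(m-1,m-1)\}$.
   Context: $\mathbb{N}$ is the set of non-negative integers. A numerical semigroup is a subset $S\subseteq\mathbb{N}$ closed under addition, with $0\in S$ and $\mathbb{N}\setminus S$ finite. The multiplicity $\mathrm{m}(S)$ is the least positive element of $S$. $\mathscr{S}_m$ is the set of numerical semigroups with multiplicity $m$. $x \bmod m$ denotes the remainder after division of $x$ by $m$. For an integer $m\ge 2$ and a finite set $A\subseteq\bigcup_{k\geq 2}\{1,\ldots,m-1\}^k$, $\mathscr{C}(m,A)$ is the set of all $S\in\mathscr{S}_m$ such that for every $k\ge 2$ and every $(s_1,\ldots,s_k)\in S^k$ with $(s_1\bmod m,\ldots,s_k\bmod m)\in A$ one has $s_1+\cdots+s_k-m\in S$. A numerical semigroup $S$ is strong if $x+y-\mathrm{m}(S)\in S$ for all $(x,y)\in(S\setminus\{0\})^2$ such that $x\not\equiv y\pmod{\mathrm{m}(S)}$. $\mathscr{R}_m$ is the set of all strong numerical semigroups with multiplicity $m$. *)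

theory Defs
  imports Main
begin

definition numerical_semigroup :: "nat set \<Rightarrow> bool" where
  "numerical_semigroup S \<longleftrightarrow>
     0 \<in> S \<and> (\<forall>x\<in>S. \<forall>y\<in>S. x + y \<in> S) \<and> finite (- S)"

definition multiplicity :: "nat set \<Rightarrow> nat" where
  "multiplicity S = (LEAST x. x \<in> S \<and> 0 < x)"

definition semigroups_of_mult :: "nat \<Rightarrow> nat set set" where
  "semigroups_of_mult m = {S. numerical_semigroup S \<and> multiplicity S = m}"

text \<open>A tuple in \<open>X\<^sup>k\<close> is encoded as a list of length \<open>k\<close> with entries in \<open>X\<close>.\<close>

definition tuples :: "nat \<Rightarrow> nat set \<Rightarrow> nat list set" where
  "tuples k X = {xs. length xs = k \<and> set xs \<subseteq> X}"

text \<open>The parameters for which the class \<open>pattern_class m A\<close> below is considered.\<close>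

definition admissible_patterns :: "nat \<Rightarrow> nat list set \<Rightarrow> bool" where
  "admissible_patterns m A \<longleftrightarrow>
     2 \<le> m \<and> finite A \<and> A \<subseteq> (\<Union>k\<in>{2..}. tuples k {1..m - 1})"

text \<open>
  The subtraction of naturals never truncates when \<open>A\<close> is admissible: each
  \<open>s \<in> set ss\<close> is then a nonzero element of \<open>S\<close>, hence at least \<open>m\<close>.
\<close>

definition pattern_class :: "nat \<Rightarrow> nat list set \<Rightarrow> nat set set" where
  "pattern_class m A =
     {S \<in> semigroups_of_mult m.
        \<forall>k\<ge>2. \<forall>ss\<in>tuples k S. map (\<lambda>s. s mod m) ss \<in> A \<longrightarrow> sum_list ss - m \<in> S}"

text \<open>Here too the subtraction never truncates, since \<open>x\<close> and \<open>y\<close> are nonzero elements of \<open>S\<close>.\<close>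

definition strong :: "nat set \<Rightarrow> bool" where
  "strong S \<longleftrightarrow> numerical_semigroup S \<and>
     (\<forall>x\<in>S - {0}. \<forall>y\<in>S - {0}.
        x mod multiplicity S \<noteq> y mod multiplicity S \<longrightarrow> x + y - multiplicity S \<in> S)"

definition strong_semigroups :: "nat \<Rightarrow> nat set set" where
  "strong_semigroups m = {S. strong S \<and> multiplicity S = m}"

definition off_diagonal_pairs :: "nat \<Rightarrow> nat list set" where
  "off_diagonal_pairs m = tuples 2 {1..m - 1} - {[i, i] | i. i \<in> {1..m - 1}}"

lemma admissible_off_diagonal_pairs:
  assumes "2 \<le> m"
  shows "admissible_patterns m (off_diagonal_pairs m)"
proof -
  have "finite (tuples 2 {1..m - 1})"
    using finite_lists_length_eq[of "{1..m - 1}" 2]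
    by (simp add: tuples_def conj_commute)
  then show ?thesis
    using assms by (auto simp: admissible_patterns_def off_diagonal_pairs_def)
qed

end

theory Submission
  imports Defs
begin

text \<open>
  The two conditions differ only in the pairs \<open>(x, y)\<close> one of whose entries is a positive multiple
  of \<open>m\<close>. If \<open>x\<close> is one, then \<open>x - m\<close> is again a multiple of \<open>m\<close>, hence in \<open>S\<close>, and so
  \<open>x + y - m \<in> S\<close> holds in every numerical semigroup of multiplicity \<open>m\<close>.
\<close>

text \<open>A cofinite set of naturals is infinite, so \<open>S\<close> has a positive element and
  the \<open>LEAST\<close> in \<open>multiplicity\<close> is attained.\<close>

lemma multiplicity_mem:
  assumes "numerical_semigroup S"
  shows "multiplicity S \<in> S"
proof -
  have "infinite S"
    using assms finite_Un[of S "- S"] by (auto simp: numerical_semigroup_def)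
  then have "\<not> S \<subseteq> {0}"
    using finite_subset by blast
  then obtain x where "x \<in> S" "0 < x"
    by auto
  then have "multiplicity S \<in> S \<and> 0 < multiplicity S"
    unfolding multiplicity_def by (intro LeastI[where P = "\<lambda>x. x \<in> S \<and> 0 < x"]) simp
  then show ?thesis by simp
qed

lemma mult_mem_numerical_semigroup:
  assumes "numerical_semigroup S" "x \<in> S"
  shows "q * x \<in> S"
  using assms by (induction q) (auto simp: numerical_semigroup_def)

lemma add_diff_multiplicity_mem:
  assumes S: "numerical_semigroup S" and "y \<in> S" "x \<noteq> 0" and dvd: "multiplicity S dvd x"
  shows "x + y - multiplicity S \<in> S"
proof -
  let ?m = "multiplicity S"
  obtain q where "x = ?m * q" using dvd by (rule dvdE)
  \<comment> \<open>As \<open>x\<close> is nonzero, its quotient by \<open>?m\<close> is a successor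
    \<open>Suc p\<close>; the copy of \<open>?m\<close> split off here is exactly what the
    subtraction cancels, so nothing is truncated.\<close>
  then obtain p where x: "x = ?m + p * ?m"
    using \<open>x \<noteq> 0\<close> by (cases q) auto
  have "p * ?m \<in> S"
    by (rule mult_mem_numerical_semigroup[OF S multiplicity_mem[OF S]])
  then have "p * ?m + y \<in> S"
    using S \<open>y \<in> S\<close> by (simp add: numerical_semigroup_def)
  then show ?thesis by (simp add: x)
qed

lemma off_diagonal_pairs_iff:
  "xs \<in> off_diagonal_pairs m \<longleftrightarrow>
     (\<exists>i j. xs = [i, j] \<and> i \<in> {1..m - 1} \<and> j \<in> {1..m - 1} \<and> i \<noteq> j)"
  by (auto simp: off_diagonal_pairs_def tuples_def length_Suc_conv numeral_2_eq_2)

text \<open>Remainders modulo \<open>m\<close> are below \<open>m\<close>, so the range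
  \<open>{1..m - 1}\<close> excludes only the remainder 0. This turns the pattern condition into
  divisibility, the form in which the two classes are compared.\<close>

lemma pair_mem_off_diagonal_pairs_iff:
  assumes "2 \<le> m"
  shows "[x mod m, y mod m] \<in> off_diagonal_pairs m \<longleftrightarrow>
           \<not> m dvd x \<and> \<not> m dvd y \<and> x mod m \<noteq> y mod m"
proof -
  have "z mod m \<in> {1..m - 1} \<longleftrightarrow> \<not> m dvd z" for z
  proof -
    have "z mod m < m" using assms by simp
    then show ?thesis unfolding dvd_eq_mod_eq_0 atLeastAtMost_iff by linarith
  qed
  then show ?thesis by (simp add: off_diagonal_pairs_iff del: atLeastAtMost_iff)
qed

theorem proposition5p3:
  fixes m :: nat
  assumes "2 \<le> m"
  shows "strong_semigroups m = pattern_class m (off_diagonal_pairs m)"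
proof (intro set_eqI iffI)
  fix S assume "S \<in> strong_semigroups m"
  then have S: "numerical_semigroup S" "multiplicity S = m"
    and strong: "\<And>x y. \<lbrakk>x \<in> S; y \<in> S; x \<noteq> 0; y \<noteq> 0; x mod m \<noteq> y mod m\<rbrakk> \<Longrightarrow> x + y - m \<in> S"
    by (auto simp: strong_semigroups_def strong_def)
  have "sum_list ss - m \<in> S"
    if "ss \<in> tuples k S" and A: "map (\<lambda>s. s mod m) ss \<in> off_diagonal_pairs m" for k ss
  proof -
    \<comment> \<open>The pattern has two entries and \<open>map\<close> preserves length, which
      settles every \<open>k\<close> at once.\<close>
    obtain x y where ss: "ss = [x, y]"
      using A by (auto simp: off_diagonal_pairs_iff)
    have "x \<in> S" "y \<in> S"
      using that(1) by (auto simp: ss tuples_def)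
    moreover have "\<not> m dvd x" "\<not> m dvd y" "x mod m \<noteq> y mod m"
      using A pair_mem_off_diagonal_pairs_iff[OF assms, of x y] by (simp_all add: ss)
    \<comment> \<open>Since \<open>m\<close> divides 0, a number not divisible by \<open>m\<close>
      is nonzero, as strongness demands.\<close>
    moreover from this have "x \<noteq> 0" "y \<noteq> 0" by (metis dvd_0_right)+
    ultimately show ?thesis using strong[of x y] by (simp add: ss)
  qed
  then show "S \<in> pattern_class m (off_diagonal_pairs m)"
    using S by (auto simp: pattern_class_def semigroups_of_mult_def)
next
  fix S assume "S \<in> pattern_class m (off_diagonal_pairs m)"
  then have S: "numerical_semigroup S" "multiplicity S = m"
    and pattern: "\<And>k ss. \<lbrakk>2 \<le> k; ss \<in> tuples k S; map (\<lambda>s. s mod m) ss \<in> off_diagonal_pairs m\<rbrakk>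
                    \<Longrightarrow> sum_list ss - m \<in> S"
    by (auto simp: pattern_class_def semigroups_of_mult_def)
  have "x + y - m \<in> S"
    if xy: "x \<in> S" "y \<in> S" "x \<noteq> 0" "y \<noteq> 0" and neq: "x mod m \<noteq> y mod m" for x y
  proof -
    \<comment> \<open>Only in the third case do the remainders form an off-diagonal pair, so that
      \<open>pattern\<close> applies; in the others a multiple of \<open>m\<close> absorbs the
      subtraction.\<close>
    consider "m dvd x" | "m dvd y" | "\<not> m dvd x" "\<not> m dvd y" by blast
    then show ?thesis
    proof cases
      case 1
      then show ?thesis using add_diff_multiplicity_mem[of S y x] S xy by simp
    next
      case 2
      then show ?thesis using add_diff_multiplicity_mem[of S x y] S xy by (simp add: add.commute)
    next
      case 3
      then show ?thesis
        using pattern[of 2 "[x, y]"] pair_mem_off_diagonal_pairs_iff[OF assms, of x y] neq xy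
        by (simp add: tuples_def)
    qed
  qed
  then show "S \<in> strong_semigroups m"
    using S by (auto simp: strong_semigroups_def strong_def)
qed

end
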